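(* Let $n\ge 1$ and let $g$ be an element of $\mathrm{Sp}(n)\ltimes\mathbb{H}^n$. Then $g$ is reversible in $\mathrm{Sp}(n)\ltimes\mathbb{H}^n$.
   Context: $\mathbb{H}$ is the division ring of Hamilton's quaternions and $\mathbb{H}^n$ is regarded as a right $\mathbb{H}$-vector space of column vectors, on which matrices act on the left. $\mathrm{Sp}(n)=\{g\in \mathrm{GL}(n,\mathbb{H}) : \bar g^{\top} g=g\bar g^{\top}=I_n\}$. Elements of $\mathrm{Sp}(n)\ltimes\mathbb{H}^n$ are pairs $(A,v)$ with $A\in\mathrm{Sp}(n)$, $v\in\mathbb{H}^n$, acting as the affine maps $z\mapsto Az+v$ of $\mathbb{H}^n$; the group operation is composition. An element $g$ of a group $G$ is reversible in $G$ if there is $h\in G$ with $hgh^{-1}=g^{-1}$. *)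

theory Defs
  imports "HOL-Analysis.Cartesian_Space" "HOL-Algebra.Group"
begin

datatype quat = Quat (Re0: real) (Im1: real) (Im2: real) (Im3: real)

lemma quat_eq_iff:
  "x = y \<longleftrightarrow> Re0 x = Re0 y \<and> Im1 x = Im1 y \<and> Im2 x = Im2 y \<and> Im3 x = Im3 y"
  by (cases x; cases y) simp

instantiation quat :: ring_1
begin

definition zero_quat :: quat where "0 = Quat 0 0 0 0"

definition one_quat :: quat where "1 = Quat 1 0 0 0"

definition plus_quat :: "quat \<Rightarrow> quat \<Rightarrow> quat" where
  "x + y = Quat (Re0 x + Re0 y) (Im1 x + Im1 y) (Im2 x + Im2 y) (Im3 x + Im3 y)"

definition uminus_quat :: "quat \<Rightarrow> quat" where
  "- x = Quat (- Re0 x) (- Im1 x) (- Im2 x) (- Im3 x)"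

definition minus_quat :: "quat \<Rightarrow> quat \<Rightarrow> quat" where
  "x - y = Quat (Re0 x - Re0 y) (Im1 x - Im1 y) (Im2 x - Im2 y) (Im3 x - Im3 y)"

definition times_quat :: "quat \<Rightarrow> quat \<Rightarrow> quat" where
  "x * y = Quat
    (Re0 x * Re0 y - Im1 x * Im1 y - Im2 x * Im2 y - Im3 x * Im3 y)
    (Re0 x * Im1 y + Im1 x * Re0 y + Im2 x * Im3 y - Im3 x * Im2 y)
    (Re0 x * Im2 y - Im1 x * Im3 y + Im2 x * Re0 y + Im3 x * Im1 y)
    (Re0 x * Im3 y + Im1 x * Im2 y - Im2 x * Im1 y + Im3 x * Re0 y)"

instance
  by intro_classes
    (simp_all add: quat_eq_iff zero_quat_def one_quat_def plus_quat_def uminus_quat_def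
      minus_quat_def times_quat_def algebra_simps)

end

lemma quat_sel_simps [simp]:
  "Re0 0 = 0" "Im1 0 = 0" "Im2 0 = 0" "Im3 0 = 0"
  "Re0 1 = 1" "Im1 1 = 0" "Im2 1 = 0" "Im3 1 = 0"
  "Re0 (x + y) = Re0 x + Re0 y" "Im1 (x + y) = Im1 x + Im1 y"
  "Im2 (x + y) = Im2 x + Im2 y" "Im3 (x + y) = Im3 x + Im3 y"
  "Re0 (- x) = - Re0 x" "Im1 (- x) = - Im1 x" "Im2 (- x) = - Im2 x" "Im3 (- x) = - Im3 x"
  "Re0 (x - y) = Re0 x - Re0 y" "Im1 (x - y) = Im1 x - Im1 y"
  "Im2 (x - y) = Im2 x - Im2 y" "Im3 (x - y) = Im3 x - Im3 y"
  by (simp_all add: zero_quat_def one_quat_def plus_quat_def uminus_quat_def minus_quat_def)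

lemma hamilton_relations:
  fixes i j k :: quat
  defines "i \<equiv> Quat 0 1 0 0" and "j \<equiv> Quat 0 0 1 0" and "k \<equiv> Quat 0 0 0 1"
  shows "i * i = - 1" "j * j = - 1" "k * k = - 1"
    and "i * j = k" "j * k = i" "k * i = j" "j * i = - k" "k * j = - i" "i * k = - j"
  by (simp_all add: i_def j_def k_def times_quat_def quat_eq_iff)

definition qcnj :: "quat \<Rightarrow> quat" where
  "qcnj x = Quat (Re0 x) (- Im1 x) (- Im2 x) (- Im3 x)"

definition qnorm2 :: "quat \<Rightarrow> real" where
  "qnorm2 x = (Re0 x)\<^sup>2 + (Im1 x)\<^sup>2 + (Im2 x)\<^sup>2 + (Im3 x)\<^sup>2"

lemma qnorm2_eq_0_iff: "qnorm2 x = 0 \<longleftrightarrow> x = 0"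
  by (simp add: qnorm2_def quat_eq_iff add_nonneg_eq_0_iff)

lemma qcnj_mult_self: "qcnj x * x = Quat (qnorm2 x) 0 0 0" "x * qcnj x = Quat (qnorm2 x) 0 0 0"
  by (simp_all add: qcnj_def qnorm2_def times_quat_def quat_eq_iff power2_eq_square)

instantiation quat :: division_ring
begin

definition inverse_quat :: "quat \<Rightarrow> quat" where
  "inverse x = Quat (1 / qnorm2 x) 0 0 0 * qcnj x"

definition "x div y = x * inverse y" for x y :: quat

instance
proof
  fix x :: quat
  assume "x \<noteq> 0"
  then have n: "qnorm2 x \<noteq> 0"
    by (simp add: qnorm2_eq_0_iff)
  have real: "Quat (1 / qnorm2 x) 0 0 0 * Quat (qnorm2 x) 0 0 0 = 1"
    using n by (simp add: times_quat_def quat_eq_iff)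
  show "inverse x * x = 1"
    by (simp only: inverse_quat_def mult.assoc qcnj_mult_self real)
  have "x * inverse x = Quat (1 / qnorm2 x) 0 0 0 * (x * qcnj x)"
    by (simp add: inverse_quat_def times_quat_def algebra_simps)
  then show "x * inverse x = 1"
    by (simp only: qcnj_mult_self real)
next
  fix x y :: quat
  show "x div y = x * inverse y"
    by (rule divide_quat_def)
  show "inverse (0::quat) = 0"
    by (simp add: inverse_quat_def times_quat_def qcnj_def qnorm2_def quat_eq_iff)
qed

end

lemma qcnj_simps [simp]:
  "qcnj 0 = 0" "qcnj 1 = 1" "qcnj (x + y) = qcnj x + qcnj y" "qcnj (qcnj x) = x"
  by (simp_all add: qcnj_def quat_eq_iff)

lemma qcnj_mult: "qcnj (x * y) = qcnj y * qcnj x"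
  by (simp add: qcnj_def times_quat_def algebra_simps)

lemma qcnj_sum: "qcnj (sum f S) = (\<Sum>x\<in>S. qcnj (f x))"
  by (induction S rule: infinite_finite_induct) simp_all

definition conj_transpose :: "quat^'n^'m \<Rightarrow> quat^'m^'n" where
  "conj_transpose A = (\<chi> i j. qcnj (A $ j $ i))"

definition Sp :: "(quat^'n^'n) set" where
  "Sp = {A. invertible A \<and> conj_transpose A ** A = mat 1 \<and> A ** conj_transpose A = mat 1}"

lemma conj_transpose_conj_transpose [simp]: "conj_transpose (conj_transpose A) = A"
  by (simp add: conj_transpose_def vec_eq_iff)

lemma conj_transpose_mat_1 [simp]: "conj_transpose (mat 1) = mat 1"
  by (simp add: conj_transpose_def mat_def vec_eq_iff)

lemma conj_transpose_mult: "conj_transpose (A ** B) = conj_transpose B ** conj_transpose A"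
  by (simp add: conj_transpose_def matrix_matrix_mult_def vec_eq_iff qcnj_sum qcnj_mult)

lemma one_in_Sp: "mat 1 \<in> Sp"
  by (auto simp: Sp_def invertible_def)

lemma conj_transpose_in_Sp: "A \<in> Sp \<Longrightarrow> conj_transpose A \<in> Sp"
  by (auto simp: Sp_def invertible_def)

lemma mult_in_Sp:
  assumes "A \<in> Sp" "B \<in> Sp"
  shows "A ** B \<in> Sp"
proof -
  have "conj_transpose (A ** B) ** (A ** B)
      = conj_transpose B ** (conj_transpose A ** A) ** B"
    by (simp add: conj_transpose_mult matrix_mul_assoc)
  also have "\<dots> = mat 1"
    using assms by (simp add: Sp_def)
  finally have 1: "conj_transpose (A ** B) ** (A ** B) = mat 1" .
  have "(A ** B) ** conj_transpose (A ** B)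
      = A ** (B ** conj_transpose B) ** conj_transpose A"
    by (simp add: conj_transpose_mult matrix_mul_assoc)
  also have "\<dots> = mat 1"
    using assms by (simp add: Sp_def)
  finally have 2: "(A ** B) ** conj_transpose (A ** B) = mat 1" .
  from 1 2 show ?thesis
    by (auto simp: Sp_def invertible_def)
qed

definition affine_act :: "(quat^'n^'n) \<times> (quat^'n) \<Rightarrow> quat^'n \<Rightarrow> quat^'n" where
  "affine_act g z = fst g *v z + snd g"

text \<open>Both \<open>*v\<close> and \<open>**\<close> multiply with the entries of the left matrix on the left, so matrices act
  linearly on the right vector space of column vectors.\<close>

definition SpAff :: "((quat^'n^'n) \<times> (quat^'n)) monoid" where
  "SpAff = \<lparr>carrier = Sp \<times> UNIV,
     monoid.mult = (\<lambda>(A, v) (B, w). (A ** B, A *v w + v)),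
     one = (mat 1, 0)\<rparr>"

text \<open>The group operation is composition of affine maps, and the action is faithful, so
  \<open>SpAff\<close> may be identified with a group of transformations.\<close>

lemma affine_act_mult:
  "affine_act (g \<otimes>\<^bsub>SpAff\<^esub> h) = affine_act g \<circ> affine_act h"
  by (auto simp: SpAff_def affine_act_def fun_eq_iff matrix_vector_right_distrib
      matrix_vector_mul_assoc add.assoc split: prod.splits)

lemma affine_act_one: "affine_act \<one>\<^bsub>SpAff\<^esub> = id"
  by (auto simp: SpAff_def affine_act_def)

lemma inj_affine_act: "inj affine_act"
proof (rule injI)
  fix g h :: "(quat^'n^'n) \<times> (quat^'n)"
  assume eq: "affine_act g = affine_act h"
  have "affine_act g 0 = affine_act h 0"
    by (simp only: eq)
  then have snd: "snd g = snd h"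
    by (simp add: affine_act_def)
  have *: "fst g *v z = fst h *v z" for z
    using fun_cong [OF eq, of z] snd by (simp add: affine_act_def)
  have col: "(A *v axis j 1) $ i = A $ i $ j" for A :: "quat^'n^'n" and i j
    by (simp add: matrix_vector_mult_def axis_def if_distrib cong: if_cong)
  have "fst g = fst h"
    unfolding vec_eq_iff using * by (metis col)
  with snd show "g = h"
    by (simp add: prod_eq_iff)
qed

lemma group_SpAff: "group (SpAff :: ((quat^'n^'n) \<times> (quat^'n)) monoid)"
proof (rule groupI)
  fix x y z :: "(quat^'n^'n) \<times> (quat^'n)"
  show "x \<otimes>\<^bsub>SpAff\<^esub> y \<in> carrier SpAff" if "x \<in> carrier SpAff" "y \<in> carrier SpAff"
    using that by (auto simp: SpAff_def mult_in_Sp)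
  show "x \<otimes>\<^bsub>SpAff\<^esub> y \<otimes>\<^bsub>SpAff\<^esub> z = x \<otimes>\<^bsub>SpAff\<^esub> (y \<otimes>\<^bsub>SpAff\<^esub> z)"
    by (rule injD [OF inj_affine_act]) (simp add: affine_act_mult comp_assoc)
  show "\<one>\<^bsub>SpAff\<^esub> \<otimes>\<^bsub>SpAff\<^esub> x = x"
    by (rule injD [OF inj_affine_act]) (simp add: affine_act_mult affine_act_one)
  show "\<exists>y\<in>carrier SpAff. y \<otimes>\<^bsub>SpAff\<^esub> x = \<one>\<^bsub>SpAff\<^esub>" if "x \<in> carrier SpAff"
  proof -
    let ?y = "(conj_transpose (fst x), - (conj_transpose (fst x) *v snd x))"
    have "fst x \<in> Sp"
      using that by (auto simp: SpAff_def)
    then have "?y \<in> carrier SpAff"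
      by (simp add: SpAff_def conj_transpose_in_Sp)
    moreover have "?y \<otimes>\<^bsub>SpAff\<^esub> x = \<one>\<^bsub>SpAff\<^esub>"
      using \<open>fst x \<in> Sp\<close> by (auto simp: SpAff_def Sp_def split: prod.splits)
    ultimately show ?thesis
      by blast
  qed
next
  show "\<one>\<^bsub>SpAff\<^esub> \<in> carrier (SpAff :: ((quat^'n^'n) \<times> (quat^'n)) monoid)"
    by (simp add: SpAff_def one_in_Sp)
qed

definition reversible_in :: "('a, 'b) monoid_scheme \<Rightarrow> 'a \<Rightarrow> bool" where
  "reversible_in G g \<longleftrightarrow>
     g \<in> carrier G \<and> (\<exists>h\<in>carrier G. h \<otimes>\<^bsub>G\<^esub> g \<otimes>\<^bsub>G\<^esub> inv\<^bsub>G\<^esub> h = inv\<^bsub>G\<^esub> g)"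

end

theory Submission
  imports Defs "HOL-Computational_Algebra.Fundamental_Theorem_Algebra"
begin

text \<open>
  Choose a maximal orthonormal set \<open>E\<close> of eigenvectors of \<open>A\<close> with complex eigenvalues,
  \<open>A e = e \<lambda>\<close>. Its orthogonal complement is \<open>A\<close>-invariant; were it nonzero, the fundamental
  theorem of algebra would supply another eigenvector there. Hence \<open>E\<close> is an orthonormal basis.
  Let \<open>B e = e \<mu>\<close>, where \<open>\<mu> = -1\<close> if \<open>\<lambda> = 1\<close> and \<open>\<mu> = j\<close> otherwise; since \<open>j\<close> conjugates
  every complex number to its complex conjugate, \<open>B A = A\<^sup>-\<^sup>1 B\<close>. For \<open>(B, w)\<close> to reverse \<open>(A, v)\<close>
  it remains to solve \<open>A\<^sup>-\<^sup>1 w - w = B v + A\<^sup>-\<^sup>1 v\<close>, which can be done coordinatewise in \<open>E\<close>: where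
  \<open>\<lambda> = 1\<close>, both sides vanish.
\<close>

section \<open>Eigenvectors of complex linear maps\<close>

text \<open>An abstract complex setting, because evaluating polynomials at an operator and splitting
  off roots need commuting scalars.\<close>

locale complex_endo = vector_space s + Vector_Spaces.linear s s T
  for s :: "complex \<Rightarrow> 'v::ab_group_add \<Rightarrow> 'v" and T :: "'v \<Rightarrow> 'v"
begin

text \<open>Horner's scheme for p(T) applied to x.\<close>

definition poly_act :: "complex poly \<Rightarrow> 'v \<Rightarrow> 'v" where
  "poly_act p x = fold_coeffs (\<lambda>a y. s a x + T y) p 0"

lemma poly_act_0 [simp]: "poly_act 0 x = 0"
  by (simp add: poly_act_def)

lemma poly_act_pCons [simp]: "poly_act (pCons a p) x = s a x + T (poly_act p x)"
  \<comment> \<open>\<open>pCons 0 0\<close> is stored as the empty coefficient list, so in this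
    case the recursion rests on \<open>T 0 = 0\<close>.\<close>
  by (cases "p = 0 \<and> a = 0") (auto simp: poly_act_def zero)

lemma poly_act_add: "poly_act (p + q) x = poly_act p x + poly_act q x"
  by (induction p q rule: poly_induct2) (simp_all add: add scale_left_distrib algebra_simps)

lemma poly_act_monom: "poly_act (monom c n) x = s c ((T ^^ n) x)"
  by (induction n) (simp_all add: monom_0 monom_Suc zero scale)

lemma poly_act_sum: "poly_act (sum f S) x = (\<Sum>i\<in>S. poly_act (f i) x)"
  by (induction S rule: infinite_finite_induct) (simp_all add: poly_act_add)

lemma poly_act_add_right: "poly_act p (x + y) = poly_act p x + poly_act p y"
  by (induction p) (simp_all add: add scale_right_distrib algebra_simps)

lemma poly_act_map: "poly_act p (T x) = T (poly_act p x)"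
  by (induction p) (simp_all add: add zero scale)

lemma poly_act_smult: "poly_act (smult c p) x = s c (poly_act p x)"
  by (induction p) (simp_all add: scale scale_right_distrib)

lemma poly_act_scale: "poly_act p (s c x) = s c (poly_act p x)"
  by (induction p) (simp_all add: scale scale_right_distrib mult.commute)

text \<open>Polynomials in T commute with T and with scalars, so the factor T - z can be applied to
  x first; this lowers the degree when a root is split off.\<close>

lemma poly_act_linear_factor: "poly_act ([:- z, 1:] * q) x = poly_act q (T x - s z x)"
proof -
  have "[:- z, 1:] * q = pCons 0 q + smult (- z) q"
    by simp
  then have "poly_act ([:- z, 1:] * q) x = T (poly_act q x) + s (- z) (poly_act q x)"
    by (simp only: poly_act_add poly_act_smult poly_act_pCons scale_zero_left add_0)
  also have "\<dots> = poly_act q (T x + s (- z) x)"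
    by (simp only: poly_act_add_right poly_act_map poly_act_scale)
  finally show ?thesis
    by simp
qed

text \<open>Split off a root z, p = (X - z) q: either x is itself an eigenvector, or T x - z x is a
  nonzero vector of W killed by q, which has smaller degree.\<close>

lemma eigenvector_of_poly_act_eq_0:
  assumes W: "subspace W" "\<And>x. x \<in> W \<Longrightarrow> T x \<in> W"
    and "p \<noteq> 0" "x \<in> W" "x \<noteq> 0" "poly_act p x = 0"
  shows "\<exists>y z. y \<in> W \<and> y \<noteq> 0 \<and> T y = s z y"
  using assms(3-)
proof (induction "degree p" arbitrary: p x)
  case 0
  then obtain c where "p = [:c:]" "c \<noteq> 0"
    by (metis degree_eq_zeroE pCons_0_0)
  with 0 show ?case
    by (simp add: zero)
next
  case (Suc d)
  then have "\<not> constant (poly p)"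
    by (simp add: constant_degree)
  then obtain z where "poly p z = 0"
    using fundamental_theorem_of_algebra by blast
  then obtain q where q: "p = [:- z, 1:] * q"
    by (metis poly_eq_0_iff_dvd dvdE)
  with \<open>p \<noteq> 0\<close> have "q \<noteq> 0"
    by auto
  have "degree p = Suc (degree q)"
    unfolding q using \<open>q \<noteq> 0\<close> by (subst degree_mult_eq) auto
  show ?case
  proof (cases "T x = s z x")
    case True
    with Suc show ?thesis
      by blast
  next
    case False
    show ?thesis
    proof (rule Suc.hyps(1))
      show "d = degree q"
        using Suc.hyps(2) \<open>degree p = Suc (degree q)\<close> by simp
      show "T x - s z x \<in> W"
        using W Suc.prems(2) by (simp add: subspace_diff subspace_scale)
      show "poly_act q (T x - s z x) = 0"
        using Suc.prems(4) by (simp only: q poly_act_linear_factor)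
    qed (use False \<open>q \<noteq> 0\<close> in auto)
  qed
qed

text \<open>The vectors x, T x, ..., T^n x with n = \<open>card B\<close> are one too many to be
  independent; a linear relation among them is the polynomial sought.\<close>

lemma ex_poly_act_eq_0:
  assumes B: "finite B" "span B = UNIV"
  shows "\<exists>p. p \<noteq> 0 \<and> poly_act p x = 0"
\<comment> \<open>Coinciding iterates merge in the set of iterates and hide a relation, so they are
  treated directly, by X^i - X^k.\<close>
proof (cases "inj_on (\<lambda>k. (T ^^ k) x) {..card B}")
  case False
  then obtain i k where ik: "i \<noteq> k" "(T ^^ i) x = (T ^^ k) x"
    by (auto simp: inj_on_def)
  have "coeff (monom 1 i + monom (- 1) k :: complex poly) i \<noteq> 0"
    using ik by simp
  then have "monom 1 i + monom (- 1) k \<noteq> (0 :: complex poly)"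
    by force
  moreover have "poly_act (monom 1 i + monom (- 1) k) x = 0"
    using ik by (simp add: poly_act_add poly_act_monom)
  ultimately show ?thesis
    by blast
next
  case True
  let ?K = "{..card B}"
  let ?S = "(\<lambda>k. (T ^^ k) x) ` ?K"
  have "card ?S = Suc (card B)"
    using True by (simp add: card_image)
  then have "dependent ?S"
    using independent_span_bound[OF B(1), of ?S] B(2) by auto
  then obtain u v where u: "v \<in> ?S" "u v \<noteq> 0" "(\<Sum>v\<in>?S. s (u v) v) = 0"
    using dependent_finite[of ?S] by auto
  from u(1) obtain k where k: "k \<in> ?K" "v = (T ^^ k) x"
    by auto
  \<comment> \<open>Injectivity turns coefficients indexed by vectors into coefficients indexed by
    exponents.\<close>
  let ?p = "\<Sum>k\<in>?K. monom (u ((T ^^ k) x)) k"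
  have "coeff ?p k = u v"
    using k by (simp add: coeff_sum)
  with u have "?p \<noteq> 0"
    by force
  moreover have "poly_act ?p x = 0"
    using u(3) by (simp add: poly_act_sum poly_act_monom sum.reindex[OF True])
  ultimately show ?thesis
    by blast
qed

lemma eigenvector_in_invariant_subspace:
  assumes "finite B" "span B = UNIV" "subspace W" "\<And>x. x \<in> W \<Longrightarrow> T x \<in> W" "x \<in> W" "x \<noteq> 0"
  obtains y z where "y \<in> W" "y \<noteq> 0" "T y = s z y"
  using ex_poly_act_eq_0[OF assms(1,2)] eigenvector_of_poly_act_eq_0[OF assms(3,4) _ assms(5,6)]
  by metis

end

section \<open>The right vector space of quaternionic columns\<close>

definition quat_of_complex :: "complex \<Rightarrow> quat" where
  "quat_of_complex z = Quat (Re z) (Im z) 0 0"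

lemma quat_of_complex_simps [simp]:
  "quat_of_complex 0 = 0" "quat_of_complex 1 = 1"
  "quat_of_complex (z + w) = quat_of_complex z + quat_of_complex w"
  "quat_of_complex (z * w) = quat_of_complex z * quat_of_complex w"
  "qcnj (quat_of_complex z) = quat_of_complex (cnj z)"
  by (simp_all add: quat_of_complex_def quat_eq_iff times_quat_def qcnj_def)

lemma quat_of_complex_eq_0_iff [simp]: "quat_of_complex z = 0 \<longleftrightarrow> z = 0"
  by (simp add: quat_of_complex_def quat_eq_iff complex_eq_iff)

text \<open>Scalars act on the right, so that they commute with matrices acting on the left.\<close>

definition rscale :: "quat^'n \<Rightarrow> quat \<Rightarrow> quat^'n" where
  "rscale x q = (\<chi> i. x $ i * q)"

lemma rscale_nth [simp]: "rscale x q $ i = x $ i * q"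
  by (simp add: rscale_def)

lemma rscale_rscale [simp]: "rscale (rscale x p) q = rscale x (p * q)"
  by (simp add: vec_eq_iff mult.assoc)

lemma rscale_1 [simp]: "rscale x 1 = x"
  by (simp add: vec_eq_iff)

lemma rscale_distrib:
  "rscale (x + y) q = rscale x q + rscale y q" "rscale x (p + q) = rscale x p + rscale x q"
  "rscale x (p - q) = rscale x p - rscale x q"
  by (simp_all add: vec_eq_iff algebra_simps)

lemma matrix_vector_mult_rscale: "A *v rscale x q = rscale (A *v x) q"
  by (simp add: vec_eq_iff matrix_vector_mult_def sum_distrib_right mult.assoc)

lemma matrix_vector_mult_sum: "A *v sum f S = (\<Sum>x\<in>S. A *v f x)" for A :: "quat^'n^'m"
  by (induction S rule: infinite_finite_induct) (simp_all add: matrix_vector_right_distrib)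

section \<open>The quaternionic Hermitian form\<close>

definition qinner :: "quat^'n \<Rightarrow> quat^'n \<Rightarrow> quat" where
  "qinner x y = (\<Sum>i\<in>UNIV. qcnj (x $ i) * y $ i)"

lemma qinner_add_right: "qinner x (y + z) = qinner x y + qinner x z"
  by (simp add: qinner_def algebra_simps sum.distrib)

lemma qinner_diff_right: "qinner x (y - z) = qinner x y - qinner x z"
  by (simp add: qinner_def algebra_simps sum_subtractf)

lemma qinner_0_right [simp]: "qinner x 0 = 0"
  by (simp add: qinner_def)

lemma qinner_sum_right: "qinner x (sum f S) = (\<Sum>y\<in>S. qinner x (f y))"
  by (induction S rule: infinite_finite_induct) (simp_all add: qinner_add_right)

lemma qinner_rscale_right: "qinner x (rscale y q) = qinner x y * q"
  by (simp add: qinner_def sum_distrib_right mult.assoc)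

lemma qinner_rscale_left: "qinner (rscale x q) y = qcnj q * qinner x y"
  by (simp add: qinner_def sum_distrib_left mult.assoc qcnj_mult)

lemma qcnj_qinner: "qcnj (qinner x y) = qinner y x"
  by (simp add: qinner_def qcnj_sum qcnj_mult)

lemma qinner_adjoint: "qinner x (A *v y) = qinner (conj_transpose A *v x) y"
proof -
  have "qinner x (A *v y) = (\<Sum>i\<in>UNIV. \<Sum>j\<in>UNIV. qcnj (x $ i) * A $ i $ j * y $ j)"
    by (simp add: qinner_def matrix_vector_mult_def sum_distrib_left mult.assoc)
  also have "\<dots> = (\<Sum>j\<in>UNIV. \<Sum>i\<in>UNIV. qcnj (x $ i) * A $ i $ j * y $ j)"
    by (rule sum.swap)
  also have "\<dots> = qinner (conj_transpose A *v x) y"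
    by (simp add: qinner_def matrix_vector_mult_def conj_transpose_def sum_distrib_right
        qcnj_sum qcnj_mult)
  finally show ?thesis .
qed

text \<open>Each \<open>qcnj q * q\<close> is real and nonnegative. Presenting the sum as an
  embedded real number allows vectors to be normalized by complex scaling.\<close>

lemma qinner_self:
  obtains r where "qinner x x = quat_of_complex (of_real r)" "r \<ge> 0" "r = 0 \<longleftrightarrow> x = 0"
proof
  let ?r = "\<Sum>i\<in>UNIV. qnorm2 (x $ i)"
  have "(\<Sum>i\<in>S. Quat (f i) 0 0 0) = Quat (sum f S) 0 0 0" for f and S :: "'a set"
    by (induction S rule: infinite_finite_induct) (simp_all add: quat_eq_iff)
  then show "qinner x x = quat_of_complex (of_real ?r)"
    by (simp add: qinner_def qcnj_mult_self quat_of_complex_def)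
  have nonneg: "qnorm2 q \<ge> 0" for q
    by (simp add: qnorm2_def)
  then show "?r \<ge> 0"
    by (simp add: sum_nonneg)
  show "?r = 0 \<longleftrightarrow> x = 0"
    using nonneg by (simp add: sum_nonneg_eq_0_iff qnorm2_eq_0_iff vec_eq_iff)
qed

section \<open>Columns as a finite-dimensional complex vector space\<close>

definition cscale :: "complex \<Rightarrow> quat^'n \<Rightarrow> quat^'n" where
  "cscale z x = rscale x (quat_of_complex z)"

text \<open>The right action satisfies the axioms of a left one because complex scalars
  commute.\<close>

interpretation cvec: vector_space "cscale :: complex \<Rightarrow> quat^'n \<Rightarrow> quat^'n"
  by unfold_locales
    (simp_all add: cscale_def rscale_distrib mult.commute flip: quat_of_complex_simps(4))

lemma complex_endo_matrix: "complex_endo cscale ((*v) A)" for A :: "quat^'n^'n"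
  by unfold_locales
    (simp_all add: matrix_vector_right_distrib cscale_def matrix_vector_mult_rscale)

text \<open>As a right complex vector space the quaternions are C + jC, so two vectors per
  coordinate suffice.\<close>

lemma finite_complex_span:
  obtains B :: "(quat^'n) set" where "finite B" "cvec.span B = UNIV"
proof
  let ?B = "range (\<lambda>i. axis i 1) \<union> range (\<lambda>i. axis i (Quat 0 0 1 0)) :: (quat^'n) set"
  show "finite ?B"
    by simp
  have "x \<in> cvec.span ?B" for x
  proof -
    \<comment> \<open>The minus sign comes from j i = -k.\<close>
    let ?y = "\<Sum>i\<in>UNIV. cscale (Complex (Re0 (x $ i)) (Im1 (x $ i))) (axis i 1)
      + cscale (Complex (Im2 (x $ i)) (- Im3 (x $ i))) (axis i (Quat 0 0 1 0))"
    have q: "quat_of_complex (Complex (Re0 q) (Im1 q))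
        + Quat 0 0 1 0 * quat_of_complex (Complex (Im2 q) (- Im3 q)) = q" for q
      by (simp add: quat_of_complex_def times_quat_def quat_eq_iff)
    have "?y $ k = x $ k" for k
    proof -
      have "?y $ k = (\<Sum>i\<in>UNIV. if i = k then x $ i else 0)"
        unfolding sum_component
        by (intro sum.cong) (auto simp: cscale_def axis_def q)
      then show ?thesis
        by simp
    qed
    then have "?y = x"
      by (simp add: vec_eq_iff)
    moreover have "?y \<in> cvec.span ?B"
      by (intro cvec.span_sum cvec.span_add cvec.span_scale cvec.span_base) auto
    ultimately show ?thesis
      by simp
  qed
  then show "cvec.span ?B = UNIV"
    by blast
qed

section \<open>Orthonormal eigenbases\<close>

definition orthonormal :: "(quat^'n) set \<Rightarrow> bool" where
  "orthonormal E \<longleftrightarrow> (\<forall>e\<in>E. \<forall>f\<in>E. qinner e f = (if e = f then 1 else 0))"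

lemma orthonormal_qinner:
  assumes "orthonormal E" "e \<in> E" "f \<in> E"
  shows "qinner e f = (if e = f then 1 else 0)"
  using assms by (simp add: orthonormal_def)

lemma orthonormal_qinner_sum:
  assumes "orthonormal E" "finite E" "e \<in> E"
  shows "qinner e (\<Sum>f\<in>E. rscale f (c f)) = c e"
proof -
  have "qinner e (\<Sum>f\<in>E. rscale f (c f)) = (\<Sum>f\<in>E. if f = e then c f else 0)"
    unfolding qinner_sum_right qinner_rscale_right
    using assms by (intro sum.cong) (auto simp: orthonormal_qinner)
  with assms show ?thesis
    by simp
qed

text \<open>Pairing a relation with v isolates the coefficient of v. This bounds the size of
  orthonormal sets, so that a largest one made of eigenvectors exists.\<close>

lemma orthonormal_independent:
  assumes "orthonormal E"
  shows "cvec.independent E"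
proof
  assume "cvec.dependent E"
  then obtain S u where S: "finite S" "S \<subseteq> E" "(\<Sum>v\<in>S. cscale (u v) v) = 0" "\<exists>v\<in>S. u v \<noteq> 0"
    unfolding cvec.dependent_explicit by blast
  then obtain v where v: "v \<in> S" "u v \<noteq> 0"
    by blast
  have "orthonormal S"
    using assms S(2) unfolding orthonormal_def by blast
  then have "qinner v (\<Sum>v\<in>S. cscale (u v) v) = quat_of_complex (u v)"
    unfolding cscale_def using S(1) v(1) by (rule orthonormal_qinner_sum)
  with S(3) v(2) show False
    by simp
qed

text \<open>As A preserves \<open>qinner\<close>, |z| = 1; hence the inverse
  \<open>conj_transpose A\<close> acts on e by z^-1, the conjugate of z.\<close>

lemma Sp_eigenvalue:
  assumes A: "A \<in> Sp" and e: "A *v e = cscale z e" "qinner e e = 1"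
  shows "cnj z * z = 1" and "conj_transpose A *v e = cscale (cnj z) e"
proof -
  have AA: "conj_transpose A *v (A *v x) = x" for x
    using A by (simp add: Sp_def matrix_vector_mul_assoc)
  have "qinner (A *v e) (A *v e) = 1"
    using e(2) by (simp add: qinner_adjoint AA)
  then have "quat_of_complex (cnj z * z) = quat_of_complex 1"
    by (simp add: e cscale_def qinner_rscale_left qinner_rscale_right)
  then show 1: "cnj z * z = 1"
    by (simp add: quat_of_complex_def complex_eq_iff)
  have "e = cscale z (conj_transpose A *v e)"
    using AA[of e] by (simp add: e(1) cscale_def matrix_vector_mult_rscale)
  then have "cscale (cnj z) e = cscale (cnj z * z) (conj_transpose A *v e)"
    by (metis cvec.scale_scale)
  then show "conj_transpose A *v e = cscale (cnj z) e"
    by (simp add: 1)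
qed

text \<open>The members of E are eigenvectors of \<open>conj_transpose A\<close> too, so moving A
  across \<open>qinner\<close> shows their orthogonal complement to be A-invariant; an eigenvector
  found there is then normalized.\<close>

lemma Sp_orthonormal_eigenvectors_extend:
  fixes A :: "quat^'n^'n"
  assumes A: "A \<in> Sp" and E: "orthonormal E" "\<And>e. e \<in> E \<Longrightarrow> \<exists>z. A *v e = cscale z e"
    and x: "\<And>e. e \<in> E \<Longrightarrow> qinner e x = 0" "x \<noteq> 0"
  obtains y z where "y \<notin> E" "orthonormal (insert y E)" "A *v y = cscale z y"
proof -
  interpret complex_endo cscale "(*v) A"
    by (rule complex_endo_matrix)
  obtain B :: "(quat^'n) set" where B: "finite B" "cvec.span B = UNIV"
    by (rule finite_complex_span)
  define W where "W = {y. \<forall>e\<in>E. qinner e y = 0}"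
  have W: "cvec.subspace W"
    by (auto simp: W_def cvec.subspace_def cscale_def qinner_add_right qinner_rscale_right)
  have "A *v y \<in> W" if y: "y \<in> W" for y
  proof -
    have "qinner e (A *v y) = 0" if e: "e \<in> E" for e
    proof -
      obtain z where "A *v e = cscale z e"
        using E(2) e by blast
      moreover have "qinner e e = 1"
        using E(1) e by (simp add: orthonormal_qinner)
      ultimately have "conj_transpose A *v e = cscale (cnj z) e"
        by (rule Sp_eigenvalue(2)[OF A])
      then show ?thesis
        using y e by (simp add: qinner_adjoint cscale_def qinner_rscale_left W_def)
    qed
    then show ?thesis
      by (simp add: W_def)
  qed
  moreover have "x \<in> W"
    using x(1) by (simp add: W_def)
  ultimately obtain u z where u: "u \<in> W" "u \<noteq> 0" "A *v u = cscale z u"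
    using eigenvector_in_invariant_subspace[OF B W] x(2) by metis
  obtain r where r: "qinner u u = quat_of_complex (of_real r)" "r \<ge> 0" "r = 0 \<longleftrightarrow> u = 0"
    by (rule qinner_self)
  \<comment> \<open>Being real, c scales \<open>qinner u u\<close> by c^2; r is positive because u
    is nonzero.\<close>
  define c where "c = 1 / sqrt r"
  have c: "c * r * c = 1"
    using r u(2) by (simp add: c_def field_simps)
  define y where "y = cscale (of_real c) u"
  have "qinner y y = quat_of_complex (of_real (c * r * c))"
    by (simp add: y_def cscale_def qinner_rscale_left qinner_rscale_right r mult.assoc)
  then have y1: "qinner y y = 1"
    by (simp add: c)
  have "y \<in> W"
    using W u(1) by (simp add: y_def cvec.subspace_scale)
  then have yE: "qinner e y = 0" "qinner y e = 0" if "e \<in> E" for e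
    using that qcnj_qinner[of e y] by (auto simp: W_def)
  show ?thesis
  proof
    \<comment> \<open>Otherwise y would be orthogonal to itself.\<close>
    show "y \<notin> E"
      using y1 yE by auto
    show "orthonormal (insert y E)"
      using E(1) y1 yE by (auto simp: orthonormal_def)
    show "A *v y = cscale z y"
      by (simp add: y_def scale u(3) mult.commute)
  qed
qed

lemma Sp_orthonormal_eigenbasis:
  fixes A :: "quat^'n^'n"
  assumes A: "A \<in> Sp"
  obtains E l where "finite E" "orthonormal E" "\<And>x. (\<Sum>e\<in>E. rscale e (qinner e x)) = x"
    "\<And>e. e \<in> E \<Longrightarrow> A *v e = cscale (l e) e"
proof -
  obtain B :: "(quat^'n) set" where B: "finite B" "cvec.span B = UNIV"
    by (rule finite_complex_span)
  have bound: "finite E \<and> card E \<le> card B" if "orthonormal E" for E :: "(quat^'n) set"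
    using cvec.independent_span_bound[OF B(1) orthonormal_independent[OF that]] B(2) by simp
  define P where "P E \<longleftrightarrow> orthonormal E \<and> (\<forall>e\<in>E. \<exists>z. A *v e = cscale z e)" for E
  have "P {}"
    by (simp add: P_def orthonormal_def)
  \<comment> \<open>The principle of the greatest element wants a strict bound, hence the
    successor.\<close>
  moreover have "\<forall>E. P E \<longrightarrow> card E < Suc (card B)"
    using bound by (simp add: P_def less_Suc_eq_le)
  ultimately obtain E where E: "P E" and max: "\<And>F. P F \<Longrightarrow> card F \<le> card E"
    using ex_has_greatest_nat[of P "{}" card "Suc (card B)"] by blast
  then have fin: "finite E" and on: "orthonormal E"
    using bound by (auto simp: P_def)
  obtain l where l: "\<And>e. e \<in> E \<Longrightarrow> A *v e = cscale (l e) e"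
    using E unfolding P_def by metis
  have "(\<Sum>e\<in>E. rscale e (qinner e x)) = x" for x
  proof (rule ccontr)
    \<comment> \<open>The residue of the orthogonal projection onto the span of E: nonzero and
      orthogonal to E, it allows an extension that contradicts maximality.\<close>
    let ?d = "x - (\<Sum>e\<in>E. rscale e (qinner e x))"
    assume "(\<Sum>e\<in>E. rscale e (qinner e x)) \<noteq> x"
    then have d: "?d \<noteq> 0"
      by simp
    have orth: "qinner e ?d = 0" if "e \<in> E" for e
      using orthonormal_qinner_sum[OF on fin that] by (simp add: qinner_diff_right)
    have eig: "\<exists>z. A *v e = cscale z e" if "e \<in> E" for e
      using l[OF that] by blast
    obtain y z where y: "y \<notin> E" "orthonormal (insert y E)" "A *v y = cscale z y"
      by (rule Sp_orthonormal_eigenvectors_extend[OF A on eig orth d])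
    then have "P (insert y E)"
      using E by (auto simp: P_def)
    then show False
      using max fin y(1) by fastforce
  qed
  from fin on this l show ?thesis
    by (rule that)
qed

section \<open>Operators diagonal in an orthonormal basis\<close>

definition diag_wrt :: "(quat^'n) set \<Rightarrow> (quat^'n \<Rightarrow> quat) \<Rightarrow> quat^'n^'n" where
  "diag_wrt E m = (\<chi> i j. \<Sum>e\<in>E. e $ i * m e * qcnj (e $ j))"

text \<open>The matrix is the sum of the matrices e (m e) e*, where e* x is
  \<open>qinner e x\<close>; thus coordinates get multiplied by \<open>m e\<close> on the
  left.\<close>

lemma diag_wrt_mult_vec: "diag_wrt E m *v x = (\<Sum>e\<in>E. rscale e (m e * qinner e x))"
proof -
  have "(diag_wrt E m *v x) $ i = (\<Sum>e\<in>E. rscale e (m e * qinner e x)) $ i" for i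
  proof -
    have "(diag_wrt E m *v x) $ i = (\<Sum>j\<in>UNIV. \<Sum>e\<in>E. e $ i * m e * qcnj (e $ j) * x $ j)"
      by (simp add: matrix_vector_mult_def diag_wrt_def sum_distrib_right)
    also have "\<dots> = (\<Sum>e\<in>E. \<Sum>j\<in>UNIV. e $ i * m e * qcnj (e $ j) * x $ j)"
      by (rule sum.swap)
    finally show ?thesis
      by (simp add: qinner_def sum_distrib_left mult.assoc)
  qed
  then show ?thesis
    by (simp add: vec_eq_iff)
qed

lemma diag_wrt_basis:
  assumes "finite E" "orthonormal E" "e \<in> E"
  shows "diag_wrt E m *v e = rscale e (m e)"
proof -
  have "diag_wrt E m *v e = (\<Sum>f\<in>E. if f = e then rscale f (m f) else 0)"
    unfolding diag_wrt_mult_vec using assms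
    by (intro sum.cong) (auto simp: orthonormal_qinner vec_eq_iff)
  with assms show ?thesis
    by simp
qed

lemma conj_transpose_diag_wrt: "conj_transpose (diag_wrt E m) = diag_wrt E (\<lambda>e. qcnj (m e))"
  by (simp add: conj_transpose_def diag_wrt_def vec_eq_iff qcnj_sum qcnj_mult mult.assoc)

text \<open>Matrices commute with right scalars, so the expansion of any x along E reduces the claim
  to E.\<close>

lemma matrix_eq_on_basis:
  fixes M N :: "quat^'n^'n"
  assumes "\<And>x. (\<Sum>e\<in>E. rscale e (qinner e x)) = x" "\<And>e. e \<in> E \<Longrightarrow> M *v e = N *v e"
  shows "M = N"
proof -
  have "M *v x = N *v x" for x
  proof -
    have "M *v (\<Sum>e\<in>E. rscale e (qinner e x)) = N *v (\<Sum>e\<in>E. rscale e (qinner e x))"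
      using assms(2) by (simp add: matrix_vector_mult_sum matrix_vector_mult_rscale)
    then show ?thesis
      by (simp add: assms(1))
  qed
  then show ?thesis
    by (simp add: matrix_eq)
qed

text \<open>On E, diagonal operators compose by multiplying their entries, and
  \<open>conj_transpose\<close> conjugates the entries; unit entries therefore give both identities
  of \<open>Sp\<close>.\<close>

lemma diag_wrt_in_Sp:
  assumes E: "finite E" "orthonormal E" "\<And>x. (\<Sum>e\<in>E. rscale e (qinner e x)) = x"
    and m: "\<And>e. e \<in> E \<Longrightarrow> qcnj (m e) * m e = 1" "\<And>e. e \<in> E \<Longrightarrow> m e * qcnj (m e) = 1"
  shows "diag_wrt E m \<in> Sp"
proof -
  have "diag_wrt E p ** diag_wrt E q = mat 1" if "\<And>e. e \<in> E \<Longrightarrow> p e * q e = 1" for p q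
    using that
    by (intro matrix_eq_on_basis[OF E(3)])
      (simp add: diag_wrt_basis[OF E(1,2)] matrix_vector_mult_rscale flip: matrix_vector_mul_assoc)
  from this[of "\<lambda>e. qcnj (m e)" m, OF m(1)] this[of m "\<lambda>e. qcnj (m e)", OF m(2)] show ?thesis
    by (auto simp: Sp_def invertible_def conj_transpose_diag_wrt)
qed

section \<open>Reversibility\<close>

text \<open>The inverse of (A, v) is (A*, -A* v). The two equations are the linear and the
  translation part of h g = g^-1 h for h = (B, w).\<close>

lemma reversible_in_SpAffI:
  fixes A B :: "quat^'n^'n"
  assumes "A \<in> Sp" "B \<in> Sp" "B ** A = conj_transpose A ** B"
    and "B *v v + w = conj_transpose A *v w - conj_transpose A *v v"
  shows "reversible_in SpAff (A, v)"
proof -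
  interpret group "SpAff :: ((quat^'n^'n) \<times> (quat^'n)) monoid"
    by (rule group_SpAff)
  have carrier: "(M, u) \<in> carrier SpAff" if "M \<in> Sp" for M :: "quat^'n^'n" and u
    using that by (simp add: SpAff_def)
  let ?g' = "(conj_transpose A, - (conj_transpose A *v v))"
  have g': "?g' \<in> carrier SpAff"
    using assms(1) by (intro carrier conj_transpose_in_Sp)
  have "?g' \<otimes>\<^bsub>SpAff\<^esub> (A, v) = \<one>\<^bsub>SpAff\<^esub>"
    using assms(1) by (simp add: SpAff_def Sp_def)
  then have inv: "inv\<^bsub>SpAff\<^esub> (A, v) = ?g'"
    using carrier[OF assms(1)] g' by (intro inv_equality)
  have "(B, w) \<otimes>\<^bsub>SpAff\<^esub> (A, v) = ?g' \<otimes>\<^bsub>SpAff\<^esub> (B, w)"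
    using assms(3,4) by (simp add: SpAff_def)
  then have "(B, w) \<otimes>\<^bsub>SpAff\<^esub> (A, v) \<otimes>\<^bsub>SpAff\<^esub> inv\<^bsub>SpAff\<^esub> (B, w) = ?g'"
    using carrier[OF assms(2)] g' by (simp add: m_assoc)
  then show ?thesis
    using carrier[OF assms(1)] carrier[OF assms(2)] unfolding reversible_in_def inv by blast
qed

text \<open>The value at z = 1 is dictated by translations: there the coordinate equation is q a + c
  = c - a, which requires q a = -a for the coordinate a of v.\<close>

lemma ex_reversing_quat:
  obtains q where "qcnj q * q = 1" "q * qcnj q = 1"
    "q * quat_of_complex z = quat_of_complex (cnj z) * q" "z = 1 \<Longrightarrow> q = - 1"
proof (cases "z = 1")
  case True
  then show ?thesis
    by (intro that[of "- 1"]) (simp_all add: qcnj_def quat_eq_iff times_quat_def)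
next
  case False
  then show ?thesis
    by (intro that[of "Quat 0 0 1 0"])
      (simp_all add: qcnj_def quat_eq_iff times_quat_def quat_of_complex_def)
qed

theorem theorem1p3:
  fixes g :: "(quat^'n^'n) \<times> (quat^'n)"
  assumes "g \<in> carrier SpAff"
  shows "reversible_in SpAff g"
proof -
  obtain A v where g: "g = (A, v)" and A: "A \<in> Sp"
    using assms by (cases g) (auto simp: SpAff_def)
  obtain E l where E: "finite E" "orthonormal E" "\<And>x. (\<Sum>e\<in>E. rscale e (qinner e x)) = x"
    and l: "\<And>e. e \<in> E \<Longrightarrow> A *v e = cscale (l e) e"
    using Sp_orthonormal_eigenbasis[OF A] by blast
  have l': "conj_transpose A *v e = cscale (cnj (l e)) e" if "e \<in> E" for e
    using that E(2) by (intro Sp_eigenvalue(2) A l) (simp_all add: orthonormal_qinner)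
  have "\<exists>q. qcnj q * q = 1 \<and> q * qcnj q = 1 \<and>
      q * quat_of_complex z = quat_of_complex (cnj z) * q \<and> (z = 1 \<longrightarrow> q = - 1)" for z
    by (metis ex_reversing_quat)
  then obtain f where f: "\<And>z. qcnj (f z) * f z = 1" "\<And>z. f z * qcnj (f z) = 1"
    "\<And>z. f z * quat_of_complex z = quat_of_complex (cnj z) * f z" "f 1 = - 1"
    by metis
  define B where "B = diag_wrt E (\<lambda>e. f (l e))"
  have Be: "B *v e = rscale e (f (l e))" if "e \<in> E" for e
    using that E by (simp add: B_def diag_wrt_basis)
  \<comment> \<open>Solves f a + c = cnj(l) c - cnj(l) a for c, with a = \<open>qinner e v\<close>.
    For \<open>l e = 1\<close> the convention \<open>inverse 0 = 0\<close> gives c = 0, and both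
    sides are -a.\<close>
  define c where "c e = inverse (quat_of_complex (cnj (l e)) - 1) *
    (f (l e) + quat_of_complex (cnj (l e))) * qinner e v" for e
  have c: "f (l e) * qinner e v + c e =
      quat_of_complex (cnj (l e)) * c e - quat_of_complex (cnj (l e)) * qinner e v" for e
  proof (cases "l e = 1")
    case True
    then show ?thesis
      by (simp add: f)
  next
    case False
    then have "quat_of_complex (cnj (l e)) - 1 \<noteq> 0"
      by (simp add: quat_of_complex_def quat_eq_iff complex_eq_iff)
    then have "(quat_of_complex (cnj (l e)) - 1) * c e =
        (f (l e) + quat_of_complex (cnj (l e))) * qinner e v"
      by (simp add: c_def mult.assoc[symmetric])
    then show ?thesis
      by (simp add: algebra_simps)
  qed
  define w where "w = (\<Sum>e\<in>E. rscale e (c e))"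
  note expand = matrix_vector_mult_sum matrix_vector_mult_rscale
  show ?thesis
    unfolding g
  proof (rule reversible_in_SpAffI[OF A])
    show "B \<in> Sp"
      unfolding B_def using E f by (intro diag_wrt_in_Sp)
    \<comment> \<open>On e in E the two sides give e f l and e cnj(l) f, equal by the choice of
      f.\<close>
    show "B ** A = conj_transpose A ** B"
      by (intro matrix_eq_on_basis[OF E(3)])
        (simp add: Be l l' f cscale_def matrix_vector_mult_rscale flip: matrix_vector_mul_assoc)
    \<comment> \<open>The translation equation is the coordinate identity \<open>c\<close> summed
      over E, once v is expanded along E.\<close>
    have "B *v v = (\<Sum>e\<in>E. rscale e (f (l e) * qinner e v))"
      by (simp add: B_def diag_wrt_mult_vec)
    then have "B *v v + w = (\<Sum>e\<in>E. rscale e (f (l e) * qinner e v + c e))"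
      by (simp add: w_def rscale_distrib sum.distrib)
    also have "\<dots> = (\<Sum>e\<in>E. rscale e (quat_of_complex (cnj (l e)) * c e)) -
        (\<Sum>e\<in>E. rscale e (quat_of_complex (cnj (l e)) * qinner e v))"
      by (simp add: c rscale_distrib sum_subtractf)
    also have "(\<Sum>e\<in>E. rscale e (quat_of_complex (cnj (l e)) * c e)) = conj_transpose A *v w"
      by (simp add: w_def expand l' cscale_def)
    also have "(\<Sum>e\<in>E. rscale e (quat_of_complex (cnj (l e)) * qinner e v)) =
        conj_transpose A *v (\<Sum>e\<in>E. rscale e (qinner e v))"
      by (simp add: expand l' cscale_def)
    also have "(\<Sum>e\<in>E. rscale e (qinner e v)) = v"
      by (rule E(3))
    finally show "B *v v + w = conj_transpose A *v w - conj_transpose A *v v" .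
  qed
qed

end
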